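(* Let $G$ be a connected $(s,c,a,k)$-graph with $a\le c$ and diameter $d$. Then $$d\le\max\left\{2s,\ (s-1)\left(\left\lfloor\frac{2(\delta-2c)}{2+M}\right\rfloor+3\right)+2\right\},$$ where $\delta$ is the minimum valency of $G$ and $M=\left\lceil\dfrac{a(c-a)}{c-1}\right\rceil$.
   Context: Graphs are simple and undirected; ${\rm d}(x,y)$ is the graph distance, and $S_h(x)$ is the set of vertices at distance exactly $h$ from $x$. Let $s,c,a,k$ be integers with $s\ge 2$, $c\ge 2$, $a+2\ge 2$ (i.e. $a\ge 0$) and $k\ge 2$. An $(s,c,a,k)$-graph is a graph of maximum valency $k$ and girth $2s-1$ or $2s$ such that: (1) $|S_{s-1}(x)\cap S_1(y)|=c$ for any two vertices $x,y$ with ${\rm d}(x,y)=s$; (2) $|S_{s-1}(x)\cap S_1(y)|=a$ for any two vertices $x,y$ with ${\rm d}(x,y)=s-1$. *)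

theory Defs
  imports "Graph_Theory.Graph_Theory" "HOL-Library.Extended_Nat"
begin

text \<open>
  A simple undirected graph is a \<^typ>\<open>'a pair_pre_digraph\<close> \<open>G\<close> satisfying
  \<^const>\<open>pair_bidirected_digraph\<close>: the arcs form a symmetric, loop-free relation on the vertex set.
  The library locale \<open>pair_graph\<close> is not used because it also requires finiteness.
\<close>

text \<open>The infimum of the empty set is \<open>\<infinity>\<close>, so unconnected vertices are at distance \<open>\<infinity>\<close>.\<close>

definition graph_dist :: "'a pair_pre_digraph \<Rightarrow> 'a \<Rightarrow> 'a \<Rightarrow> enat" where
  "graph_dist G x y = (INF p \<in> {p. pre_digraph.awalk G x p y}. enat (length p))"

definition sphere :: "'a pair_pre_digraph \<Rightarrow> nat \<Rightarrow> 'a \<Rightarrow> 'a set" where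
  "sphere G h x = {y \<in> pverts G. graph_dist G x y = enat h}"

definition graph_diameter :: "'a pair_pre_digraph \<Rightarrow> enat" where
  "graph_diameter G = (SUP x \<in> pverts G. SUP y \<in> pverts G. graph_dist G x y)"

text \<open>
  In a symmetric digraph every edge traversed back and forth is a cycle of length 2 in the sense of
  \<^const>\<open>pre_digraph.cycle\<close>; the length restriction leaves exactly the cycles of the undirected
  graph. An acyclic graph has girth \<open>\<infinity>\<close>.
\<close>

definition girth :: "'a pair_pre_digraph \<Rightarrow> enat" where
  "girth G = (INF p \<in> {p. pre_digraph.cycle G p \<and> 3 \<le> length p}. enat (length p))"

text \<open>
  The valency of a vertex is its \<^const>\<open>out_degree\<close>. As \<^const>\<open>card\<close> of an infinite set is 0,
  a bound on the valencies has to demand local finiteness separately.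
\<close>

definition has_max_valency :: "'a pair_pre_digraph \<Rightarrow> nat \<Rightarrow> bool" where
  "has_max_valency G k \<longleftrightarrow>
     (\<forall>x \<in> pverts G. finite (out_arcs G x) \<and> out_degree G x \<le> k) \<and>
     (\<exists>x \<in> pverts G. out_degree G x = k)"

definition min_valency :: "'a pair_pre_digraph \<Rightarrow> nat" where
  "min_valency G = (INF x \<in> pverts G. out_degree G x)"

definition scak_graph :: "nat \<Rightarrow> nat \<Rightarrow> nat \<Rightarrow> nat \<Rightarrow> 'a pair_pre_digraph \<Rightarrow> bool" where
  "scak_graph s c a k G \<longleftrightarrow>
     2 \<le> s \<and> 2 \<le> c \<and> 2 \<le> k \<and>
     pair_bidirected_digraph G \<and>
     has_max_valency G k \<and>
     girth G \<in> {enat (2 * s - 1), enat (2 * s)} \<and>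
     (\<forall>x \<in> pverts G. \<forall>y \<in> pverts G. graph_dist G x y = enat s \<longrightarrow>
        card (sphere G (s - 1) x \<inter> sphere G 1 y) = c) \<and>
     (\<forall>x \<in> pverts G. \<forall>y \<in> pverts G. graph_dist G x y = enat (s - 1) \<longrightarrow>
        card (sphere G (s - 1) x \<inter> sphere G 1 y) = a)"

end

theory Submission
  imports Defs
begin

text \<open>
  Fix a vertex \<open>x\<close>, put \<open>f = d(x, \<cdot>)\<close> and let \<open>\<Delta>(v)\<close> be the sum of \<open>f(w) - f(v)\<close> over the neighbours
  \<open>w\<close> of \<open>v\<close>. If \<open>d(u, v) = s - 1\<close>, then, apart from the two neighbours lying on the geodesic between
  \<open>u\<close> and \<open>v\<close>, the neighbours of \<open>u\<close> and those of \<open>v\<close> form a \<open>(c - 1)\<close>-regular bipartite multigraph: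
  pairs at distance \<open>s - 1\<close> are joined once and pairs at distance \<open>s - 2\<close> are joined \<open>c - a\<close> times.
  Hence \<open>u\<close> and \<open>v\<close> have the same valency, and transporting \<open>f\<close> along this multigraph gives
  \<open>\<Delta>(v) \<le> \<Delta>(u) - (2 + M)\<close> whenever \<open>f(v) = f(u) + s - 1\<close>. On a geodesic from \<open>x\<close> to \<open>y\<close> a vertex \<open>v\<close>
  satisfies \<open>\<Delta>(v) \<le> deg v - 2 c\<close> once it is at distance at least \<open>s\<close> from \<open>x\<close>, and
  \<open>\<Delta>(v) \<ge> 2 c - deg v\<close> as long as it is at distance at least \<open>s\<close> from \<open>y\<close>. This bounds the number of
  steps of length \<open>s - 1\<close> in between. Finally, if the diameter exceeds \<open>2 s\<close>, all neighbours of a vertex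
  have the same valency, so at least one of the vertices at distance \<open>s\<close> and \<open>s + 1\<close> from \<open>x\<close> on the
  geodesic has minimum valency.
\<close>

section \<open>Distances and geodesics in a connected graph\<close>

locale connected_bidirected_digraph = pair_bidirected_digraph +
  assumes conn: "connected G"
begin

definition nbrs :: "'a \<Rightarrow> 'a set" where
  "nbrs x = {y. (x, y) \<in> parcs G}"

text \<open>Connectedness makes distances between vertices finite, so \<open>the_enat\<close> loses
  nothing there.\<close>

definition dst :: "'a \<Rightarrow> 'a \<Rightarrow> nat" where
  "dst x y = the_enat (graph_dist G x y)"

lemma nbrs_sym: "y \<in> nbrs x \<longleftrightarrow> x \<in> nbrs y"
  unfolding nbrs_def using arcs_symmetric by blast

lemma nbrs_verts: "y \<in> nbrs x \<Longrightarrow> y \<in> pverts G" "y \<in> nbrs x \<Longrightarrow> x \<in> pverts G"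
  unfolding nbrs_def by (auto dest: wellformed')

lemma nbrs_irrefl: "x \<notin> nbrs x"
  unfolding nbrs_def using pair_no_loops by force

lemma ex_awalk:
  assumes "x \<in> pverts G" "y \<in> pverts G"
  shows "\<exists>p. awalk x p y"
proof -
  have "strongly_connected G"
    using symmetric_connected_imp_strongly_connected[OF pair_sym_arcs conn] .
  then show ?thesis
    using assms by (auto elim!: strongly_connectedE simp: reachable_awalk)
qed

lemma graph_dist_le: "awalk x p y \<Longrightarrow> graph_dist G x y \<le> enat (length p)"
  unfolding graph_dist_def by (rule INF_lower) simp

lemma graph_dist_attained:
  assumes "x \<in> pverts G" "y \<in> pverts G"
  obtains p where "awalk x p y" "graph_dist G x y = enat (length p)"
proof -
  have "(INF p \<in> {p. awalk x p y}. enat (length p)) \<in> (\<lambda>p. enat (length p)) ` {p. awalk x p y}"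
    using ex_awalk[OF assms] unfolding Inf_enat_def
    by (auto intro: LeastI)
  then show thesis using that unfolding graph_dist_def by auto
qed

lemma graph_dist_eq:
  assumes "x \<in> pverts G" "y \<in> pverts G"
  shows "graph_dist G x y = enat (dst x y)"
  using graph_dist_attained[OF assms] unfolding dst_def by (metis the_enat.simps)

lemma dst_le: "awalk x p y \<Longrightarrow> dst x y \<le> length p"
  using graph_dist_le[of x p y] graph_dist_eq[of x y] awalk_hd_in_verts awalk_last_in_verts
  by (metis enat_ord_simps(1))

lemma dst_attained:
  assumes "x \<in> pverts G" "y \<in> pverts G"
  obtains p where "awalk x p y" "length p = dst x y"
  using graph_dist_attained[OF assms] graph_dist_eq[OF assms] by (metis enat.inject)

lemma dst_self: "x \<in> pverts G \<Longrightarrow> dst x x = 0"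
  using dst_le[of x "[]" x] by (simp add: awalk_Nil_iff)

lemma dst_eq_0: 
  assumes "x \<in> pverts G" "y \<in> pverts G"
  shows "dst x y = 0 \<longleftrightarrow> x = y"
proof
  assume "dst x y = 0"
  then show "x = y" using dst_attained[OF assms] by (metis awalk_Nil_iff length_0_conv)
qed (use dst_self assms in auto)

lemma dst_triangle:
  assumes "x \<in> pverts G" "y \<in> pverts G" "z \<in> pverts G"
  shows "dst x z \<le> dst x y + dst y z"
proof -
  obtain p where p: "awalk x p y" "length p = dst x y" using dst_attained assms by metis
  obtain q where q: "awalk y q z" "length q = dst y z" using dst_attained assms by metis
  have "awalk x (p @ q) z" using p q by auto
  from dst_le[OF this] p q show ?thesis by simp
qed

lemma dst_sym_le:
  assumes "x \<in> pverts G" "y \<in> pverts G"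
  shows "dst y x \<le> dst x y"
proof -
  obtain p where p: "awalk x p y" "length p = dst x y" using dst_attained assms by metis
  have "length (rev_path p) = length p" by (induct p) auto
  with dst_le[of y "rev_path p" x] p show ?thesis by simp
qed

lemma dst_sym: "x \<in> pverts G \<Longrightarrow> y \<in> pverts G \<Longrightarrow> dst x y = dst y x"
  using dst_sym_le by (simp add: le_antisym)

lemma dst_nbr:
  assumes "y \<in> nbrs x"
  shows "dst x y = 1"
proof -
  have "awalk x [(x, y)] y"
    using assms nbrs_verts[OF assms] by (auto simp: nbrs_def awalk_simps)
  from dst_le[OF this] show ?thesis
    using dst_eq_0[OF nbrs_verts(2)[OF assms] nbrs_verts(1)[OF assms]] assms nbrs_irrefl
    by (cases "dst x y") auto
qed

lemma dst_1_iff: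
  assumes "x \<in> pverts G" "y \<in> pverts G"
  shows "dst x y = 1 \<longleftrightarrow> y \<in> nbrs x"
proof
  assume "dst x y = 1"
  then obtain p where p: "awalk x p y" "length p = 1" using dst_attained assms by metis
  then obtain e where "p = [e]" by (auto simp: length_Suc_conv)
  with p show "y \<in> nbrs x" by (cases e) (auto simp: awalk_simps nbrs_def)
qed (rule dst_nbr)

lemma dst_nbr_le:
  assumes "w \<in> nbrs v" "x \<in> pverts G"
  shows "dst x w \<le> dst x v + 1" "dst x v \<le> dst x w + 1"
  using dst_triangle[of x v w] dst_triangle[of x w v] assms nbrs_verts[OF assms(1)] dst_nbr
    nbrs_sym[of w v] by auto

text \<open>On a shortest walk, counting steps gives \<open>dst (g i) (g j) \<le> j - i\<close>;
  strict inequality would violate the triangle inequality along \<open>x\<close>,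
  \<open>g i\<close>, \<open>g j\<close>, \<open>y\<close>.\<close>

lemma geodesic:
  assumes "x \<in> pverts G" "y \<in> pverts G"
  obtains g where "g 0 = x" "g (dst x y) = y"
    "\<And>i. i < dst x y \<Longrightarrow> g (Suc i) \<in> nbrs (g i)"
    "\<And>i. i \<le> dst x y \<Longrightarrow> g i \<in> pverts G"
    "\<And>i. i \<le> dst x y \<Longrightarrow> dst x (g i) = i"
    "\<And>i j. i \<le> j \<Longrightarrow> j \<le> dst x y \<Longrightarrow> dst (g i) (g j) = j - i"
proof -
  obtain p where p: "awalk x p y" "length p = dst x y" using dst_attained assms by metis
  have ex: "\<exists>g. g 0 = x \<and> g (length p) = y \<and> (\<forall>i<length p. g (Suc i) \<in> nbrs (g i))"
    using p(1)
  proof (induct p arbitrary: x)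
    case Nil
    then show ?case by (auto simp: awalk_Nil_iff)
  next
    case (Cons e p)
    then obtain g where g: "g 0 = snd e" "g (length p) = y" "\<forall>i<length p. g (Suc i) \<in> nbrs (g i)"
      by (auto simp: awalk_Cons_iff)
    define g' where "g' = case_nat x g"
    have "g' 0 = x \<and> g' (length (e # p)) = y \<and> (\<forall>i<length (e # p). g' (Suc i) \<in> nbrs (g' i))"
      using g Cons.prems by (auto simp: g'_def nbrs_def awalk_Cons_iff split: nat.splits)
    then show ?case by blast
  qed
  then obtain g where g: "g 0 = x" "g (dst x y) = y" "\<And>i. i < dst x y \<Longrightarrow> g (Suc i) \<in> nbrs (g i)"
    using p(2) by auto
  have V: "g i \<in> pverts G" if "i \<le> dst x y" for i
    using g(3)[of "i - 1"] assms(1) g(1) that nbrs_verts by (cases i) auto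
  have le: "dst (g i) (g j) \<le> j - i" if "i \<le> j" "j \<le> dst x y" for i j
    using that
  proof (induct j rule: dec_induct)
    case base
    then show ?case using V dst_self by simp
  next
    case (step n)
    then have "dst (g i) (g (Suc n)) \<le> dst (g i) (g n) + 1"
      using dst_nbr_le(1)[OF g(3)[of n] V[of i]] by simp
    then show ?case using step by simp
  qed
  have eq: "dst (g i) (g j) = j - i" if "i \<le> j" "j \<le> dst x y" for i j
  proof -
    have "dst x y \<le> dst x (g i) + dst (g i) y" "dst (g i) y \<le> dst (g i) (g j) + dst (g j) y"
      using dst_triangle V assms that by auto
    then show ?thesis
      using le[of 0 i] le[of j "dst x y"] le[OF that] g(1,2) that by simp
  qed
  have "dst x (g i) = i" if "i \<le> dst x y" for i
    using eq[of 0 i] g(1) that by simp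
  then show thesis
    using that[of g] g V eq by presburger
qed

lemma nbr_towards:
  assumes "x \<in> pverts G" "y \<in> pverts G" "dst x y = Suc n"
  obtains w where "w \<in> nbrs y" "dst x w = n"
proof -
  obtain g where "g (dst x y) = y" "\<And>i. i < dst x y \<Longrightarrow> g (Suc i) \<in> nbrs (g i)"
    "\<And>i. i \<le> dst x y \<Longrightarrow> dst x (g i) = i"
    using geodesic[OF assms(1,2)] by metis
  then have "y \<in> nbrs (g n)" "dst x (g n) = n"
    using assms(3) by (metis lessI, simp)
  then show thesis using that nbrs_sym by blast
qed

section \<open>Short cycles and what the girth forbids\<close>

text \<open>Injectivity is asked on \<open>{1..n}\<close> because \<open>cycle\<close> wants the
  vertices after the first to be distinct, the first reappearing at the end.\<close>

lemma girth_le_cycle: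
  assumes "3 \<le> n" "g n = g 0" "inj_on g {1..n}" "\<And>i. i < n \<Longrightarrow> g (Suc i) \<in> nbrs (g i)"
  shows "girth G \<le> enat n"
proof -
  let ?p = "map (\<lambda>i. (g i, g (Suc i))) [0..<n]"
  have "awalk (g 0) (map (\<lambda>i. (g i, g (Suc i))) [0..<m]) (g m)" if "m \<le> n" for m
    using that
  proof (induct m)
    case 0
    then show ?case using assms(1) assms(4)[of 0] nbrs_verts by (auto simp: awalk_Nil_iff)
  next
    case (Suc m)
    moreover have "awalk (g m) [(g m, g (Suc m))] (g (Suc m))"
      using assms(4)[of m] Suc.prems nbrs_verts[of "g (Suc m)" "g m"]
      by (auto simp: awalk_simps nbrs_def)
    ultimately show ?case by auto
  qed
  then have w: "awalk (g 0) ?p (g 0)" using assms(2) by (metis order_refl)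
  then have "tl (awalk_verts (g 0) ?p) = map snd ?p"
    using assms(1) by (subst awalk_verts_conv') (auto simp: awalk_def)
  also have "\<dots> = map g (map Suc [0..<n])" by simp
  finally have "distinct (tl (awalk_verts (g 0) ?p))"
    using assms(3) by (simp add: distinct_map atLeastLessThanSuc_atLeastAtMost
      image_Suc_atLeastLessThan del: map_map upt_Suc)
  then have "cycle ?p" unfolding cycle_def using w assms(1) by auto
  then have "girth G \<le> enat (length ?p)"
    unfolding girth_def using assms(1) by (intro INF_lower) simp
  then show ?thesis by simp
qed

text \<open>The cycle leaves the last common vertex of the two geodesics along one and returns along the other.\<close>

lemma girth_le_geodesics:
  assumes t: "t \<in> pverts G" and vs: "v \<in> pverts G" "w \<in> pverts G" "w \<in> nbrs v"
    and le: "dst t w \<le> dst t v"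
    and p: "p 0 = t" "p (dst t v) = v" "\<And>i. i < dst t v \<Longrightarrow> p (Suc i) \<in> nbrs (p i)"
      "\<And>i. i \<le> dst t v \<Longrightarrow> dst t (p i) = i"
    and q: "q 0 = t" "q (dst t w) = w" "\<And>i. i < dst t w \<Longrightarrow> q (Suc i) \<in> nbrs (q i)"
      "\<And>i. i \<le> dst t w \<Longrightarrow> dst t (q i) = i"
    and ne: "p (dst t w) \<noteq> w"
  shows "girth G \<le> enat (dst t v + dst t w + 1)"
proof -
  define m n where "m = dst t v" and "n = dst t w"
  define j where "j = Max {j. j \<le> n \<and> p j = q j}"
  have fin: "finite {j. j \<le> n \<and> p j = q j}" by simp
  have "0 \<in> {j. j \<le> n \<and> p j = q j}" using p q by simp
  then have "j \<in> {j. j \<le> n \<and> p j = q j}" unfolding j_def using fin Max_in by blast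
  \<comment> \<open>\<open>ne\<close> puts the branching point strictly below \<open>w\<close>, so
    both arms are nonempty and the cycle has length at least 3.\<close>
  then have j: "j < n" "p j = q j" using ne q(2) unfolding n_def by (auto simp: le_less)
  have jmax: "p i \<noteq> q i" if "j < i" "i \<le> n" for i
    using that Max_ge[OF fin, of i] unfolding j_def by fastforce
  have nm: "n \<le> m" using le m_def n_def by simp
  define L where "L = m - j"
  \<comment> \<open>\<open>g\<close> climbs \<open>p\<close> from the branching point to
    \<open>v\<close> at index \<open>L\<close>, crosses to \<open>w\<close> at \<open>L + 1\<close>
    and descends \<open>q\<close>, returning to the branching point at index
    \<open>N\<close>.\<close>
  define g where "g i = (if i \<le> L then p (j + i) else q (n + L + 1 - i))" for i
  define N where "N = L + 1 + (n - j)"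
  have "N \<ge> 3" using j nm unfolding N_def L_def by auto
  moreover have "g N = g 0" using j unfolding g_def N_def by auto
  moreover have "inj_on g {1..N}"
  proof (rule inj_onI)
    have lev: "dst t (g i) = (if i \<le> L then j + i else n + L + 1 - i)" if "i \<in> {1..N}" for i
    proof (cases "i \<le> L")
      case True
      then have "j + i \<le> m" using j nm unfolding L_def by simp
      then show ?thesis using p(4)[of "j + i"] True unfolding g_def m_def by simp
    next
      case False
      then have "n + L + 1 - i \<le> n" by simp
      then show ?thesis using q(4)[of "n + L + 1 - i"] False unfolding g_def n_def by simp
    qed
    \<comment> \<open>Equal vertices have equal distance from \<open>t\<close>, so a meeting of the
      two arms would be an agreement of \<open>p\<close> and \<open>q\<close> above level
      \<open>j\<close>.\<close>
    have cross: "g i \<noteq> g i'" if "i \<in> {1..N}" "i' \<in> {1..N}" "i \<le> L" "\<not> i' \<le> L" for i i'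
    proof
      assume eq: "g i = g i'"
      then have "j + i = n + L + 1 - i'" using lev[OF that(1)] lev[OF that(2)] that by simp
      moreover from this have "j < j + i" "j + i \<le> n"
        using that by auto
      ultimately show False using jmax[of "j + i"] eq that unfolding g_def by metis
    qed
    fix i i' assume ii: "i \<in> {1..N}" "i' \<in> {1..N}" "g i = g i'"
    have iff: "i \<le> L \<longleftrightarrow> i' \<le> L" using cross[OF ii(1,2)] cross[OF ii(2,1)] ii(3) by argo
    have lev_eq: "(if i \<le> L then j + i else n + L + 1 - i) = (if i' \<le> L then j + i' else n + L + 1 - i')"
      using lev[OF ii(1)] lev[OF ii(2)] ii(3) by argo
    have "i \<le> n + L + 1" "i' \<le> n + L + 1" using ii j unfolding N_def by auto
    then show "i = i'" using iff lev_eq by (cases "i \<le> L") auto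
  qed
  moreover have "g (Suc i) \<in> nbrs (g i)" if "i < N" for i
  proof -
    consider "i < L" | "i = L" | "L < i" by linarith
    then show ?thesis
    proof cases
      case 1
      then show ?thesis using p(3)[of "j + i"] unfolding g_def L_def m_def by simp
    next
      case 2
      then show ?thesis using vs(3) p(2) q(2) j nm unfolding g_def L_def m_def n_def by simp
    next
      case 3
      define k where "k = n + L - i"
      have "k < n" "n + L + 1 - i = Suc k" "n + L + 1 - Suc i = k"
        using 3 that j unfolding k_def N_def by auto
      then show ?thesis using 3 q(3)[of k] nbrs_sym unfolding g_def n_def by simp
    qed
  qed
  ultimately have "girth G \<le> enat N" by (rule girth_le_cycle)
  also have "enat N \<le> enat (dst t v + dst t w + 1)"
    using j nm unfolding N_def L_def m_def n_def by simp
  finally show ?thesis .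
qed

text \<open>Otherwise geodesics to \<open>v\<close> through \<open>w'\<close> and to
  \<open>w\<close> close up into a cycle of length at most \<open>2 * dst t v\<close>.\<close>

lemma unique_nbr_towards:
  assumes "t \<in> pverts G" "w \<in> nbrs v" "w' \<in> nbrs v" "dst t w + 1 = dst t v" "dst t w' + 1 = dst t v"
    and girth: "enat (2 * dst t v) < girth G"
  shows "w = w'"
proof (rule ccontr)
  assume ne: "w \<noteq> w'"
  have V: "v \<in> pverts G" "w \<in> pverts G" "w' \<in> pverts G" using assms nbrs_verts by auto
  obtain q where q: "q 0 = t" "q (dst t w) = w" "\<And>i. i < dst t w \<Longrightarrow> q (Suc i) \<in> nbrs (q i)"
    "\<And>i. i \<le> dst t w \<Longrightarrow> dst t (q i) = i"
    using geodesic[OF assms(1) V(2)] by metis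
  obtain p' where p': "p' 0 = t" "p' (dst t w') = w'" 
    "\<And>i. i < dst t w' \<Longrightarrow> p' (Suc i) \<in> nbrs (p' i)"
    "\<And>i. i \<le> dst t w' \<Longrightarrow> dst t (p' i) = i"
    using geodesic[OF assms(1) V(3)] by metis
  define p where "p i = (if i = dst t v then v else p' i)" for i
  have "girth G \<le> enat (dst t v + dst t w + 1)"
  proof (rule girth_le_geodesics[OF assms(1) V(1,2) assms(2), where p = p and q = q])
    show "p (Suc i) \<in> nbrs (p i)" if "i < dst t v" for i
    proof (cases "Suc i = dst t v")
      case True
      then have "i = dst t w'" using assms(5) by simp
      then show ?thesis using True p'(2) assms(3) nbrs_sym[of v w'] unfolding p_def by simp
    qed (use that p'(3)[of i] assms(5) in \<open>auto simp: p_def\<close>)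
    have "dst t w = dst t w'" "dst t w \<noteq> dst t v" using assms(4,5) by auto
    then show "p (dst t w) \<noteq> w" using p'(2) ne unfolding p_def by simp
  qed (use p' q assms ne in \<open>auto simp: p_def\<close>)
  also have "dst t v + dst t w + 1 = 2 * dst t v" using assms by simp
  finally show False using girth by simp
qed

text \<open>Otherwise geodesics to both ends of the edge close up into a cycle of length at most
  \<open>2 * dst t v + 1\<close>.\<close>

lemma no_nbr_same_dst:
  assumes "t \<in> pverts G" "w \<in> nbrs v" and girth: "enat (2 * dst t v + 1) < girth G"
  shows "dst t w \<noteq> dst t v"
proof
  assume eq: "dst t w = dst t v"
  have V: "v \<in> pverts G" "w \<in> pverts G" using assms nbrs_verts by auto
  obtain p where p: "p 0 = t" "p (dst t v) = v" "\<And>i. i < dst t v \<Longrightarrow> p (Suc i) \<in> nbrs (p i)"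
    "\<And>i. i \<le> dst t v \<Longrightarrow> dst t (p i) = i"
    using geodesic[OF assms(1) V(1)] by metis
  obtain q where q: "q 0 = t" "q (dst t w) = w" "\<And>i. i < dst t w \<Longrightarrow> q (Suc i) \<in> nbrs (q i)"
    "\<And>i. i \<le> dst t w \<Longrightarrow> dst t (q i) = i"
    using geodesic[OF assms(1) V(2)] by metis
  have "p (dst t w) \<noteq> w" using eq p(2) assms(2) nbrs_irrefl by auto
  then have "girth G \<le> enat (dst t v + dst t w + 1)"
    by (intro girth_le_geodesics[OF assms(1) V assms(2) _ p q]) (use eq in auto)
  then show False using girth eq by (simp add: mult_2)
qed

end

text \<open>The parameter \<open>r\<close> stands for \<open>s - 1\<close>.\<close>

locale scak_connected = connected_bidirected_digraph +
  fixes r c a :: nat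
  assumes r_ge_1: "1 \<le> r" and c_ge_2: "2 \<le> c" and a_le_c: "a \<le> c"
    and finite_nbrs: "\<And>x. x \<in> pverts G \<Longrightarrow> finite (nbrs x)"
    and girth_ge: "enat (2 * r + 1) \<le> girth G"
    and card_nbrs_towards: "\<And>x y. x \<in> pverts G \<Longrightarrow> y \<in> pverts G \<Longrightarrow> dst x y = Suc r \<Longrightarrow>
      card {w \<in> nbrs y. dst x w = r} = c"
    and card_nbrs_level: "\<And>x y. x \<in> pverts G \<Longrightarrow> y \<in> pverts G \<Longrightarrow> dst x y = r \<Longrightarrow>
      card {w \<in> nbrs y. dst x w = r} = a"
begin

lemma less_girth: "n \<le> 2 * r \<Longrightarrow> enat n < girth G"
  using girth_ge by (metis Suc_eq_plus1 enat_ord_simps(2) le_imp_less_Suc order_less_le_trans)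

section \<open>The bipartite multigraph between two neighbourhoods\<close>

text \<open>The multiplicity with which \<open>z\<close> and \<open>w\<close> are joined; an
  \<open>int\<close>, as it will weight signed differences of distances.\<close>

definition transport_weight :: "'a \<Rightarrow> 'a \<Rightarrow> int" where
  "transport_weight z w =
    of_bool (dst z w = r) + (int c - int a) * of_bool (dst z w + 1 = r)"

text \<open>If \<open>dst v z = r\<close>, then \<open>a\<close> neighbours of \<open>v\<close> are
  at distance \<open>r\<close> from \<open>z\<close>, one of them \<open>v'\<close>, and exactly one
  is at distance \<open>r - 1\<close>, for a total of \<open>(a - 1) + (c - a)\<close>. If
  \<open>dst v z = r + 1\<close>, then \<open>c\<close> neighbours are at distance \<open>r\<close>,
  again including \<open>v'\<close>, and none is nearer.\<close>

lemma transport_row: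
  assumes V: "u \<in> pverts G" "v \<in> pverts G" and uv: "dst u v = r"
    and u': "u' \<in> nbrs u" "dst v u' + 1 = r" and v': "v' \<in> nbrs v" "dst u v' + 1 = r"
    and z: "z \<in> nbrs u - {u'}"
  shows "(\<Sum>w \<in> nbrs v - {v'}. of_bool (dst z w + 1 = r) :: int) = of_bool (dst v z = r)" (is ?one)
    and "(\<Sum>w \<in> nbrs v - {v'}. transport_weight z w) = int c - 1" (is ?sum)
proof -
  have V': "z \<in> pverts G" "u' \<in> pverts G" "v' \<in> pverts G" using z u' v' nbrs_verts by auto
  have vu: "dst v u = r" using uv V dst_sym by simp
  have fin: "finite (nbrs v)" using V finite_nbrs by simp
  \<comment> \<open>By the girth, \<open>u'\<close> is the only neighbour of \<open>u\<close> nearer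
    to \<open>v\<close>.\<close>
  have "dst v z + 1 \<noteq> r"
    using unique_nbr_towards[OF V(2), of z u u'] z u' vu less_girth by auto
  moreover have "dst v z \<le> r + 1" "r \<le> dst v z + 1" using dst_nbr_le[OF _ V(2), of z u] z vu by auto
  ultimately have vz: "dst v z = r \<or> dst v z = Suc r" by auto
  have zv: "dst z v = dst v z" using dst_sym V V' by simp
  \<comment> \<open>\<open>z\<close> is adjacent to \<open>u\<close>, which is at distance
    \<open>r - 1\<close> from \<open>v'\<close>. The girth excludes that same distance for
    \<open>z\<close>, and a smaller one would bring \<open>z\<close> within \<open>r - 1\<close> of
    \<open>v\<close>.\<close>
  have zv': "dst z v' = r"
  proof -
    have "dst v' z = r"
    proof (rule antisym)
      have "dst v' z \<le> dst v' u + 1" using dst_nbr_le(1)[OF _ V'(3), of z u] z by simp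
      then show "dst v' z \<le> r" using v'(2) dst_sym[OF V(1) V'(3)] by simp
      have "r \<le> dst v' z + 1"
        using vz zv dst_nbr_le(2)[OF v'(1) V'(1)] dst_nbr_le(1)[OF v'(1) V'(1)] dst_sym[OF V'(1,3)] by auto
      moreover have "dst v' z \<noteq> dst v' u"
        using no_nbr_same_dst[OF V'(3), of z u] z v'(2) dst_sym[OF V(1) V'(3)] less_girth by simp
      ultimately show "r \<le> dst v' z" using v'(2) dst_sym[OF V(1) V'(3)] by simp
    qed
    then show ?thesis using dst_sym V' by simp
  qed
  have towards: "card {w \<in> nbrs v - {v'}. dst z w + 1 = r} = of_bool (dst v z = r)"
  proof (cases "dst v z = r")
    case True
    then obtain w where w: "w \<in> nbrs v" "dst z w = r - 1"
      using nbr_towards[OF V'(1) V(2), of "r - 1"] zv r_ge_1 by auto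
    have "w0 = w" if "w0 \<in> nbrs v" "dst z w0 + 1 = r" for w0
      using unique_nbr_towards[OF V'(1) that(1) w(1)] that(2) w(2) zv True r_ge_1 less_girth
      by simp
    moreover have "w \<in> nbrs v - {v'}" "dst z w + 1 = r" using w zv' r_ge_1 by auto
    ultimately have "{w \<in> nbrs v - {v'}. dst z w + 1 = r} = {w}" by blast
    then show ?thesis using True by simp
  next
    case False
    then have "dst z w + 1 \<noteq> r" if "w \<in> nbrs v" for w
      using vz zv dst_nbr_le(2)[OF that V'(1)] by simp
    then have none: "{w \<in> nbrs v - {v'}. dst z w + 1 = r} = {}" by auto
    show ?thesis using False unfolding none by simp
  qed
  show one: ?one
    using towards fin by (simp add: sum_of_bool_eq Int_def conj_commute)
  have "card {w \<in> nbrs v. dst z w = r} = (if dst v z = r then a else c)"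
    using vz card_nbrs_level card_nbrs_towards V V' zv by auto
  moreover have "{w \<in> nbrs v - {v'}. dst z w = r} = {w \<in> nbrs v. dst z w = r} - {v'}" by auto
  moreover have "v' \<in> {w \<in> nbrs v. dst z w = r}" using v' zv' by simp
  ultimately have "int (card {w \<in> nbrs v - {v'}. dst z w = r}) = int (if dst v z = r then a else c) - 1"
    using fin card_Suc_Diff1[of "{w \<in> nbrs v. dst z w = r}" v'] by auto
  then have "(\<Sum>w \<in> nbrs v - {v'}. of_bool (dst z w = r) :: int) = int (if dst v z = r then a else c) - 1"
    using fin by (simp add: sum_of_bool_eq Int_def conj_commute)
  then show ?sum
    unfolding transport_weight_def sum.distrib sum_distrib_left[symmetric] one by simp
qed

lemma transport_weight_sym:
  "z \<in> pverts G \<Longrightarrow> w \<in> pverts G \<Longrightarrow> transport_weight z w = transport_weight w z"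
  unfolding transport_weight_def using dst_sym by simp

text \<open>The row computation with \<open>u\<close> and \<open>v\<close> interchanged.\<close>

lemma transport_col:
  assumes V: "u \<in> pverts G" "v \<in> pverts G" and uv: "dst u v = r"
    and u': "u' \<in> nbrs u" "dst v u' + 1 = r" and v': "v' \<in> nbrs v" "dst u v' + 1 = r"
    and w: "w \<in> nbrs v - {v'}"
  shows "(\<Sum>z \<in> nbrs u - {u'}. transport_weight z w) = int c - 1"
proof -
  have "(\<Sum>z \<in> nbrs u - {u'}. transport_weight z w) = (\<Sum>z \<in> nbrs u - {u'}. transport_weight w z)"
    using w nbrs_verts by (intro sum.cong transport_weight_sym) auto
  also have "\<dots> = int c - 1"
    using transport_row(2)[OF V(2,1) _ v' u' w] uv dst_sym[OF V] by simp
  finally show ?thesis .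
qed

text \<open>These are the geodesic neighbours left out of the multigraph. For \<open>r = 1\<close>
  they are \<open>v\<close> and \<open>u\<close> themselves.\<close>

lemma feet:
  assumes V: "u \<in> pverts G" "v \<in> pverts G" and uv: "dst u v = r"
  obtains u' v' where "u' \<in> nbrs u" "dst v u' + 1 = r" "v' \<in> nbrs v" "dst u v' + 1 = r"
  using nbr_towards[OF V, of "r - 1"] nbr_towards[OF V(2,1), of "r - 1"] uv dst_sym[OF V] r_ge_1
  by (metis Suc_eq_plus1 Suc_pred' less_eq_Suc_le One_nat_def)

text \<open>Count the edges of the multigraph from either side: its degree \<open>c - 1\<close> is
  positive, and one neighbour was removed on each side.\<close>

lemma card_nbrs_eq:
  assumes V: "u \<in> pverts G" "v \<in> pverts G" and uv: "dst u v = r"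
  shows "card (nbrs u) = card (nbrs v)"
proof -
  obtain u' v' where u': "u' \<in> nbrs u" "dst v u' + 1 = r" and v': "v' \<in> nbrs v" "dst u v' + 1 = r"
    using feet[OF assms] by metis
  have "(int c - 1) * int (card (nbrs u - {u'}))
    = (\<Sum>z \<in> nbrs u - {u'}. \<Sum>w \<in> nbrs v - {v'}. transport_weight z w)"
    using transport_row(2)[OF V uv u' v'] by simp
  also have "\<dots> = (\<Sum>w \<in> nbrs v - {v'}. \<Sum>z \<in> nbrs u - {u'}. transport_weight z w)"
    by (rule sum.swap)
  also have "\<dots> = (int c - 1) * int (card (nbrs v - {v'}))"
    using transport_col[OF V uv u' v'] by simp
  finally have "card (nbrs u - {u'}) = card (nbrs v - {v'})" using c_ge_2 by simp
  then show ?thesis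
    using u' v' finite_nbrs[OF V(1)] finite_nbrs[OF V(2)] by (metis card_Suc_Diff1)
qed

section \<open>The Laplacian of the distance from a vertex\<close>

text \<open>The \<Delta>(v) of the overview: the graph Laplacian of \<open>dst x\<close> at
  \<open>v\<close>.\<close>

definition lap :: "'a \<Rightarrow> 'a \<Rightarrow> int" where
  "lap x v = (\<Sum>w \<in> nbrs v. int (dst x w) - int (dst x v))"

lemma lap_remove:
  assumes "v \<in> pverts G" "v' \<in> nbrs v"
  shows "lap x v = int (dst x v') + (\<Sum>w \<in> nbrs v - {v'}. int (dst x w)) - int (card (nbrs v)) * int (dst x v)"
  unfolding lap_def using assms finite_nbrs by (simp add: sum_subtractf sum.remove)

text \<open>By regularity, summing \<open>f w - f z\<close> over the edges of the multigraph gives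
  \<open>c - 1\<close> times \<open>sum f Y - sum f X\<close>. Each edge contributes at most
  \<open>r\<close>, and each of the \<open>a * (c - a)\<close> edges between vertices at distance
  \<open>r - 1\<close> at most \<open>r - 1\<close>. The removed neighbours account for the 2.
  Keeping the factor \<open>c - 1\<close> avoids division.\<close>

lemma lap_step:
  assumes x: "x \<in> pverts G" and V: "u \<in> pverts G" "v \<in> pverts G" and uv: "dst u v = r"
    and xv: "dst x v = dst x u + r"
  shows "(int c - 1) * (lap x v - lap x u + 2) \<le> - (int a * (int c - int a))"
proof -
  obtain u' v' where u': "u' \<in> nbrs u" "dst v u' + 1 = r" and v': "v' \<in> nbrs v" "dst u v' + 1 = r"
    using feet[OF V uv] by metis
  define X Y where "X = nbrs u - {u'}" and "Y = nbrs v - {v'}"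
  have fin: "finite X" "finite Y" using finite_nbrs V unfolding X_def Y_def by auto
  have XV: "z \<in> pverts G" if "z \<in> X" for z using that nbrs_verts unfolding X_def by auto
  have YV: "w \<in> pverts G" if "w \<in> Y" for w using that nbrs_verts unfolding Y_def by auto
  define f where "f w = int (dst x w)" for w
  note row = transport_row[OF V uv u' v', folded X_def Y_def]
  note col = transport_col[OF V uv u' v', folded X_def Y_def]
  have le: "transport_weight z w * (f w - f z) \<le>
      int r * transport_weight z w - (int c - int a) * of_bool (dst z w + 1 = r)"
    if "z \<in> X" "w \<in> Y" for z w
  proof -
    have "f w - f z \<le> int (dst z w)"
      using dst_triangle[OF x XV[OF that(1)] YV[OF that(2)]] unfolding f_def by simp
    moreover have "(int c - int a) * (f w - f z) \<le> (int c - int a) * (int r - 1)"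
      if "dst z w + 1 = r"
      using calculation that a_le_c by (intro mult_left_mono) auto
    ultimately show ?thesis
      unfolding transport_weight_def by (auto simp: algebra_simps)
  qed
  have "{z \<in> nbrs u. dst v z = r} = {z \<in> X. dst v z = r}" using u' unfolding X_def by auto
  then have cardA: "card {z \<in> X. dst v z = r} = a"
    using card_nbrs_level[OF V(2,1)] uv dst_sym[OF V] by simp
  have "(int c - 1) * (sum f Y - sum f X)
    = (\<Sum>w\<in>Y. f w * (\<Sum>z\<in>X. transport_weight z w)) - (\<Sum>z\<in>X. f z * (\<Sum>w\<in>Y. transport_weight z w))"
  proof -
    have "(\<Sum>w\<in>Y. f w * (\<Sum>z\<in>X. transport_weight z w)) = sum f Y * (int c - 1)"
      unfolding sum_distrib_right using col by (intro sum.cong) simp_all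
    moreover have "(\<Sum>z\<in>X. f z * (\<Sum>w\<in>Y. transport_weight z w)) = sum f X * (int c - 1)"
      unfolding sum_distrib_right using row(2) by (intro sum.cong) simp_all
    ultimately show ?thesis by (simp add: algebra_simps)
  qed
  also have "\<dots> = (\<Sum>z\<in>X. \<Sum>w\<in>Y. transport_weight z w * (f w - f z))"
    unfolding sum_distrib_left right_diff_distrib sum_subtractf
    by (subst sum.swap) (simp add: mult.commute)
  also have "\<dots> \<le> (\<Sum>z\<in>X. \<Sum>w\<in>Y. int r * transport_weight z w - (int c - int a) * of_bool (dst z w + 1 = r))"
    by (intro sum_mono le)
  also have "\<dots> = (\<Sum>z\<in>X. int r * (int c - 1) - (int c - int a) * of_bool (dst v z = r))"
    by (intro sum.cong refl) (simp only: sum_subtractf sum_distrib_left[symmetric] row)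
  also have "\<dots> = int r * (int c - 1) * int (card X) - (int c - int a) * (\<Sum>z\<in>X. of_bool (dst v z = r))"
    by (simp add: sum_subtractf sum_distrib_left[symmetric])
  also have "(\<Sum>z\<in>X. of_bool (dst v z = r) :: int) = int a"
    using cardA fin by (simp add: sum_of_bool_eq Int_def conj_commute)
  finally have main: "(int c - 1) * (sum f Y - sum f X) \<le> int r * (int c - 1) * int (card X) - (int c - int a) * int a" .
  have V': "u' \<in> pverts G" "v' \<in> pverts G" using u' v' nbrs_verts by auto
  \<comment> \<open>\<open>v'\<close> is at most \<open>r - 1\<close> farther from \<open>x\<close>
    than \<open>u\<close> is, and \<open>u'\<close> at least 1 farther.\<close>
  have "f v' - f u' \<le> int r - 2"
  proof -
    have "dst x v' \<le> dst x u + dst u v'" "dst x v \<le> dst x u' + dst u' v"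
      using dst_triangle x V V' by auto
    then show ?thesis using xv u'(2) v'(2) dst_sym[OF V(2) V'(1)] unfolding f_def by simp
  qed
  moreover have "card (nbrs u) = card X + 1" "card (nbrs v) = card X + 1"
    using card_nbrs_eq[OF V uv] u'(1) finite_nbrs[OF V(1)] card_Suc_Diff1[of "nbrs u" u'] unfolding X_def by auto
  then have "lap x v - lap x u = f v' - f u' + (sum f Y - sum f X) - (int (card X) + 1) * int r"
    using lap_remove[OF V(1) u'(1), of x] lap_remove[OF V(2) v'(1), of x] xv
    unfolding f_def X_def Y_def by (simp add: algebra_simps)
  ultimately have "lap x v - lap x u + 2 \<le> (sum f Y - sum f X) - int (card X) * int r"
    by (simp add: algebra_simps)
  then have "(int c - 1) * (lap x v - lap x u + 2) \<le> (int c - 1) * ((sum f Y - sum f X) - int (card X) * int r)"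
    using c_ge_2 by (intro mult_left_mono) auto
  also have "\<dots> \<le> - (int a * (int c - int a))"
    using main by (simp add: algebra_simps)
  finally show ?thesis .
qed

text \<open>Take the vertex at distance \<open>r + 1\<close> from \<open>y\<close> on a geodesic
  from \<open>x\<close>: the \<open>c\<close> neighbours of \<open>y\<close> nearer to it are also
  nearer to \<open>x\<close>.\<close>

lemma card_nbrs_towards_far:
  assumes V: "x \<in> pverts G" "y \<in> pverts G" and far: "Suc r \<le> dst x y"
  shows "c \<le> card {w \<in> nbrs y. dst x w + 1 = dst x y}"
proof -
  obtain g where g: "g 0 = x" "g (dst x y) = y"
    "\<And>i. i \<le> dst x y \<Longrightarrow> g i \<in> pverts G"
    "\<And>i. i \<le> dst x y \<Longrightarrow> dst x (g i) = i"
    "\<And>i j. i \<le> j \<Longrightarrow> j \<le> dst x y \<Longrightarrow> dst (g i) (g j) = j - i"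
    using geodesic[OF V] by metis
  define x' where "x' = g (dst x y - Suc r)"
  have x': "x' \<in> pverts G" "dst x' y = Suc r" "dst x x' = dst x y - Suc r"
    using g(3)[of "dst x y - Suc r"] g(4)[of "dst x y - Suc r"] g(5)[of "dst x y - Suc r" "dst x y"]
      g(2) far unfolding x'_def by auto
  have "{w \<in> nbrs y. dst x' w = r} \<subseteq> {w \<in> nbrs y. dst x w + 1 = dst x y}"
  proof clarify
    fix w assume w: "w \<in> nbrs y" "r = dst x' w"
    have "dst x w \<le> dst x x' + dst x' w" using dst_triangle V x' w nbrs_verts by metis
    then show "dst x w + 1 = dst x y"
      using dst_nbr_le(2)[OF w(1) V(1)] x' w far by simp
  qed
  then have "card {w \<in> nbrs y. dst x' w = r} \<le> card {w \<in> nbrs y. dst x w + 1 = dst x y}"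
    using finite_nbrs[OF V(2)] by (intro card_mono) auto
  then show ?thesis using card_nbrs_towards[OF x'(1) V(2) x'(2)] by simp
qed

text \<open>Each element of \<open>B\<close> lowers the trivial bound \<open>card N\<close> by
  2.\<close>

lemma sum_le_card_diff:
  fixes g :: "'b \<Rightarrow> int"
  assumes "finite N" "B \<subseteq> N" "\<And>w. w \<in> N \<Longrightarrow> g w \<le> 1" "\<And>w. w \<in> B \<Longrightarrow> g w \<le> -1" "k \<le> card B"
  shows "sum g N \<le> int (card N) - 2 * int k"
proof -
  have "sum g N \<le> (\<Sum>w\<in>N. 1 - 2 * of_bool (w \<in> B))"
    using assms by (intro sum_mono) force
  also have "\<dots> = int (card N) - 2 * int (card B)"
    using assms(1,2) by (simp add: sum_subtractf sum_distrib_left[symmetric] Int_absorb1 sum_of_bool_eq)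
  finally show ?thesis using assms(5) by simp
qed

lemma lap_upper:
  assumes V: "x \<in> pverts G" "v \<in> pverts G" and "Suc r \<le> dst x v"
  shows "lap x v \<le> int (card (nbrs v)) - 2 * int c"
  unfolding lap_def
proof (rule sum_le_card_diff)
  show "c \<le> card {w \<in> nbrs v. dst x w + 1 = dst x v}" using card_nbrs_towards_far[OF assms] .
  show "int (dst x w) - int (dst x v) \<le> 1" if "w \<in> nbrs v" for w
    using dst_nbr_le[OF that V(1)] by simp
qed (use finite_nbrs V in auto)

text \<open>By \<open>geo\<close>, the neighbours of \<open>v\<close> nearer to \<open>y\<close>, at
  least \<open>c\<close> in number, are farther from \<open>x\<close>; the estimate is then applied
  to the negated sum.\<close>

lemma lap_lower:
  assumes V: "x \<in> pverts G" "v \<in> pverts G" "y \<in> pverts G"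
    and far: "Suc r \<le> dst v y" and geo: "dst x y = dst x v + dst v y"
  shows "2 * int c - int (card (nbrs v)) \<le> lap x v"
proof -
  have "(\<Sum>w \<in> nbrs v. int (dst x v) - int (dst x w)) \<le> int (card (nbrs v)) - 2 * int c"
  proof (rule sum_le_card_diff)
    show "c \<le> card {w \<in> nbrs v. dst y w + 1 = dst y v}"
      using card_nbrs_towards_far[OF V(3,2)] far dst_sym[OF V(2,3)] by simp
    show "int (dst x v) - int (dst x w) \<le> 1" if "w \<in> nbrs v" for w
      using dst_nbr_le[OF that V(1)] by simp
    show "int (dst x v) - int (dst x w) \<le> - 1" if "w \<in> {w \<in> nbrs v. dst y w + 1 = dst y v}" for w
    proof -
      have "w \<in> pverts G" using that nbrs_verts by auto
      then show ?thesis
        using dst_triangle[OF V(1) _ V(3), of w] that geo dst_sym[OF V(3)] V(2) by auto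
    qed
  qed (use finite_nbrs V in auto)
  then show ?thesis unfolding lap_def by (simp add: sum_subtractf)
qed

section \<open>Valencies of vertices with a common neighbour\<close>

text \<open>For \<open>r = 1\<close> adjacent vertices have equal valency. Otherwise all neighbours
  of \<open>t\<close> except \<open>t1\<close> are at distance \<open>r\<close> from some
  \<open>p'\<close> and share its valency; \<open>t1\<close> and \<open>t2\<close> are both at
  distance \<open>r\<close> from \<open>p\<close>, so \<open>t2\<close> ties \<open>t1\<close> to
  the rest.\<close>

lemma card_nbrs_eq_common_nbr:
  assumes V: "t \<in> pverts G" "p \<in> pverts G" and tp: "dst t p = Suc r"
    and w: "w \<in> nbrs t" "w' \<in> nbrs t"
  shows "card (nbrs w) = card (nbrs w')"
proof (cases "r = 1")
  case True
  have "card (nbrs w) = card (nbrs t)" if "w \<in> nbrs t" for w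
    using card_nbrs_eq[of t w] dst_nbr[OF that] that nbrs_verts True by auto
  then show ?thesis using w by simp
next
  case False
  then have r: "2 \<le> r" using r_ge_1 by simp
  have pt: "dst p t = Suc r" using tp dst_sym V by simp
  define T where "T = {w \<in> nbrs t. dst p w = r}"
  have "2 \<le> card T" using card_nbrs_towards[OF V(2,1) pt] c_ge_2 unfolding T_def by simp
  then obtain t1 t2 where t12: "t1 \<in> T" "t2 \<in> T" "t1 \<noteq> t2"
    by (metis card_le_Suc0_iff_eq card.infinite not_less_eq_eq numeral_2_eq_2 zero_le)
  then have tV: "t1 \<in> pverts G" "t2 \<in> pverts G" using nbrs_verts unfolding T_def by auto
  have t1p: "dst t1 p = r" using t12 dst_sym[OF V(2) tV(1)] unfolding T_def by simp
  obtain g where g: "g 0 = t1" "g (dst t1 p) = p"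
    "\<And>i. i \<le> dst t1 p \<Longrightarrow> g i \<in> pverts G"
    "\<And>i. i \<le> dst t1 p \<Longrightarrow> dst t1 (g i) = i"
    "\<And>i j. i \<le> j \<Longrightarrow> j \<le> dst t1 p \<Longrightarrow> dst (g i) (g j) = j - i"
    using geodesic[OF tV(1) V(2)] by metis
  \<comment> \<open>By the girth, \<open>t1\<close> is the only neighbour of \<open>t\<close> that is not at distance \<open>r\<close> from this vertex.\<close>
  define p' where "p' = g (r - 2)"
  have p': "p' \<in> pverts G" "dst t1 p' = r - 2" "dst p' p = 2"
    using g(2) g(3)[of "r - 2"] g(4)[of "r - 2"] g(5)[of "r - 2" r] t1p r unfolding p'_def by auto
  have p't1: "dst p' t1 = r - 2" using p' dst_sym[OF tV(1)] by simp
  have t1t: "t1 \<in> nbrs t" using t12 unfolding T_def by simp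
  have "dst t p \<le> dst t p' + dst p' p" using dst_triangle V p' by blast
  \<comment> \<open>At most \<open>r - 1\<close> through \<open>t1\<close>; anything less would put
    \<open>t\<close> within \<open>r\<close> of \<open>p\<close>.\<close>
  then have p't: "dst p' t = r - 1"
    using dst_nbr_le(2)[OF t1t p'(1)] p't1 p'(3) tp r dst_sym[OF V(1) p'(1)] by simp
  have deg_p': "card (nbrs w) = card (nbrs p')" if "w \<in> nbrs t" "w \<noteq> t1" for w
  proof -
    have "dst p' w \<noteq> r - 1"
      using no_nbr_same_dst[OF p'(1) that(1)] p't less_girth r by simp
    moreover have "dst p' w \<noteq> r - 2"
    proof
      assume "dst p' w = r - 2"
      then have "dst p' w + 1 = dst p' t" "dst p' t1 + 1 = dst p' t" using p't p't1 r by auto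
      then have "w = t1"
        using unique_nbr_towards[OF p'(1) that(1) t1t] p't less_girth by simp
      then show False using that(2) by simp
    qed
    ultimately have "dst p' w = r"
      using dst_nbr_le[OF that(1) p'(1)] p't r by linarith
    then show ?thesis using card_nbrs_eq[OF p'(1) nbrs_verts(1)[OF that(1)]] by simp
  qed
  have "card (nbrs t1) = card (nbrs p)" "card (nbrs t2) = card (nbrs p)"
    using card_nbrs_eq[OF V(2) tV(1)] card_nbrs_eq[OF V(2) tV(2)] t12 unfolding T_def by auto
  then have "card (nbrs w) = card (nbrs p')" if "w \<in> nbrs t" for w
    using deg_p'[of w] deg_p'[of t2] t12 that unfolding T_def by auto
  then show ?thesis using w by simp
qed

text \<open>As \<open>x\<close> and \<open>y\<close> are far apart, every vertex has another at
  distance \<open>r + 1\<close>, so the neighbours of any vertex share one valency.\<close>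

lemma card_nbrs_on_edge:
  assumes far: "x \<in> pverts G" "y \<in> pverts G" "2 * r + 2 < dst x y"
    and m: "m \<in> pverts G" and e: "w \<in> nbrs v"
  shows "card (nbrs v) = card (nbrs m) \<or> card (nbrs w) = card (nbrs m)"
proof -
  have common: "card (nbrs w) = card (nbrs w')" if w: "w \<in> nbrs t" "w' \<in> nbrs t" for t w w'
  proof -
    have t: "t \<in> pverts G" using w nbrs_verts by auto
    have "dst x y \<le> dst t x + dst t y"
      using dst_triangle[OF far(1) t far(2)] dst_sym[OF t far(1)] by simp
    then have "Suc r \<le> dst t x \<or> Suc r \<le> dst t y" using far(3) by linarith
    then obtain q where q: "q \<in> pverts G" "Suc r \<le> dst t q" using far(1,2) by blast
    obtain g where g: 
      "\<And>i. i \<le> dst t q \<Longrightarrow> g i \<in> pverts G"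
      "\<And>i. i \<le> dst t q \<Longrightarrow> dst t (g i) = i"
      using geodesic[OF t q(1)] by metis
    show ?thesis
      using card_nbrs_eq_common_nbr[OF t g(1)[OF q(2)] g(2)[OF q(2)] w] .
  qed
  have vV: "v \<in> pverts G" using e nbrs_verts by auto
  obtain g where g: "g 0 = m" "g (dst m v) = v"
    "\<And>i. i < dst m v \<Longrightarrow> g (Suc i) \<in> nbrs (g i)"
    using geodesic[OF m vV] by metis
  \<comment> \<open>If \<open>g i\<close> has the valency of \<open>m\<close>, so do all neighbours
    of \<open>g (Suc i)\<close>, \<open>g i\<close> being one of them; otherwise all neighbours of
    \<open>g i\<close> do, including \<open>g (Suc i)\<close>.\<close>
  have "card (nbrs (g i)) = card (nbrs m) \<or> (\<forall>w \<in> nbrs (g i). card (nbrs w) = card (nbrs m))"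
    if "i \<le> dst m v" for i
    using that
  proof (induct i)
    case 0
    then show ?case using g by simp
  next
    case (Suc i)
    then have i: "g (Suc i) \<in> nbrs (g i)" "g i \<in> nbrs (g (Suc i))" using g(3)[of i] nbrs_sym by auto
    show ?case
    proof (cases "card (nbrs (g i)) = card (nbrs m)")
      case True
      then show ?thesis using common[OF i(2)] by metis
    next
      case False
      then show ?thesis using Suc i by auto
    qed
  qed
  then show ?thesis using g(2) e by (metis order_refl)
qed

section \<open>Bounding a long distance\<close>

text \<open>Each step of length \<open>r\<close> along a geodesic keeps the valency and lowers
  \<open>lap x\<close> by at least \<open>2 + M\<close>. It starts at most
  \<open>\<delta> - 2 * c\<close> and ends at least \<open>2 * c - \<delta>\<close>, which bounds
  the number of steps.\<close>

lemma dst_bound: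
  fixes M :: int
  assumes V: "x \<in> pverts G" "y \<in> pverts G" and far: "2 * r + 2 < dst x y"
    and m: "m \<in> pverts G"
    and M: "M = \<lceil>real a * (real c - real a) / (real c - 1)\<rceil>"
  shows "int (dst x y) \<le>
    int r * (\<lfloor>2 * (real (card (nbrs m)) - 2 * real c) / (2 + real_of_int M)\<rfloor> + 3) + 2"
proof -
  define D \<delta> where "D = dst x y" and "\<delta> = card (nbrs m)"
  obtain g where g: "g 0 = x" "g D = y"
    "\<And>i. i < D \<Longrightarrow> g (Suc i) \<in> nbrs (g i)"
    "\<And>i. i \<le> D \<Longrightarrow> g i \<in> pverts G"
    "\<And>i. i \<le> D \<Longrightarrow> dst x (g i) = i"
    "\<And>i j. i \<le> j \<Longrightarrow> j \<le> D \<Longrightarrow> dst (g i) (g j) = j - i"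
    using geodesic[OF V] unfolding D_def by metis
  have D: "2 * r + 2 < D" using far D_def by simp
  have M0: "0 \<le> M"
  proof -
    have "0 \<le> real a * (real c - real a) / (real c - 1)" using a_le_c c_ge_2 by simp
    then show ?thesis unfolding M by linarith
  qed
  \<comment> \<open>Both candidates are at distance at least \<open>r + 1\<close> from
    \<open>x\<close>, where \<open>lap_upper\<close> applies.\<close>
  have "card (nbrs (g (Suc r))) = \<delta> \<or> card (nbrs (g (Suc (Suc r)))) = \<delta>"
    unfolding \<delta>_def using card_nbrs_on_edge[OF V far m g(3)] D by simp
  then obtain i0 where i0: "i0 = Suc r \<or> i0 = Suc (Suc r)" "card (nbrs (g i0)) = \<delta>" by blast
  have step: "lap x (g (i + r)) \<le> lap x (g i) - (2 + M)" if "i + r \<le> D" for i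
  proof -
    \<comment> \<open>As an integer, \<open>K\<close> is at least the ceiling \<open>M\<close> once
      it is at least the fraction.\<close>
    define K where "K = - (lap x (g (i + r)) - lap x (g i) + 2)"
    have "(int c - 1) * (lap x (g (i + r)) - lap x (g i) + 2) \<le> - (int a * (int c - int a))"
      using lap_step[OF V(1) g(4)[of i] g(4)[of "i + r"]] g(5)[of i] g(5)[of "i + r"] g(6)[of i "i + r"] that
      by simp
    then have "int a * (int c - int a) \<le> (int c - 1) * K"
      unfolding K_def mult_minus_right by linarith
    then have "real_of_int (int a * (int c - int a)) \<le> real_of_int ((int c - 1) * K)"
      using of_int_le_iff by blast
    then have "real a * (real c - real a) / (real c - 1) \<le> real_of_int K"
      using c_ge_2 by (simp add: divide_le_eq mult.commute)
    then have "M \<le> K" unfolding M by (rule ceiling_le)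
    then show ?thesis unfolding K_def by simp
  qed
  have chain: "card (nbrs (g (i0 + q * r))) = \<delta> \<and> lap x (g (i0 + q * r)) \<le> lap x (g i0) - int q * (2 + M)"
    if "i0 + q * r \<le> D" for q
    using that
  proof (induct q)
    case 0
    then show ?case using i0 by simp
  next
    case (Suc q)
    then have le: "i0 + q * r + r \<le> D" by (simp add: add.assoc add.commute)
    then have "card (nbrs (g (i0 + q * r))) = card (nbrs (g (i0 + q * r + r)))"
      using g(4)[of "i0 + q * r"] g(4)[of "i0 + q * r + r"] g(6)[of "i0 + q * r" "i0 + q * r + r"]
      by (intro card_nbrs_eq) auto
    then show ?case using Suc step[OF le] le by (simp add: algebra_simps)
  qed
  \<comment> \<open>The largest number of steps that ends at distance at least \<open>r + 1\<close>
    from \<open>y\<close>, as \<open>lap_lower\<close> requires. Since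
    \<open>D \<ge> 2 * r + 3\<close> and \<open>i0 \<le> r + 2\<close>, the subtraction is not
    truncated.\<close>
  define q where "q = (D - Suc r - i0) div r"
  define e where "e = i0 + q * r"
  have "q * r \<le> D - Suc r - i0" unfolding q_def by simp
  then have e: "e + Suc r \<le> D" "Suc r \<le> i0" "i0 \<le> D" using D i0 unfolding e_def by auto
  have "2 * int c - int \<delta> \<le> lap x (g e)"
    using lap_lower[OF V(1) g(4)[of e] V(2)] g(2) g(5)[of e] g(6)[of e D] chain[of q] e
    unfolding e_def D_def by simp
  also have "\<dots> \<le> lap x (g i0) - int q * (2 + M)" using chain[of q] e unfolding e_def by simp
  also have "lap x (g i0) \<le> int \<delta> - 2 * int c"
    using lap_upper[OF V(1) g(4)[of i0]] g(5)[of i0] e i0 by simp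
  finally have "int q * (2 + M) \<le> 2 * (int \<delta> - 2 * int c)" by simp
  then have "real_of_int (int q * (2 + M)) \<le> real_of_int (2 * (int \<delta> - 2 * int c))"
    using of_int_le_iff by blast
  then have "real_of_int (int q) \<le> 2 * (real \<delta> - 2 * real c) / (2 + real_of_int M)"
    using M0 by (simp add: le_divide_eq)
  then have qF: "int q \<le> \<lfloor>2 * (real \<delta> - 2 * real c) / (2 + real_of_int M)\<rfloor>"
    by (simp only: le_floor_iff)
  \<comment> \<open>In the worst case \<open>i0 = r + 2\<close> this gives
    \<open>D < r * (q + 3) + 3\<close>, whence the final 2.\<close>
  have "D - Suc r - i0 < r * (q + 1)"
    using r_ge_1 dividend_less_times_div[of r "D - Suc r - i0"] unfolding q_def by simp
  then have "D \<le> r * (q + 3) + 2" using i0 D by (auto simp: algebra_simps)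
  then have "int D \<le> int r * (int q + 3) + 2"
    by (metis (mono_tags) of_nat_add of_nat_le_iff of_nat_mult of_nat_numeral)
  also have "\<dots> \<le> int r * (\<lfloor>2 * (real \<delta> - 2 * real c) / (2 + real_of_int M)\<rfloor> + 3) + 2"
    using qF by (simp add: mult_left_mono)
  finally show ?thesis unfolding D_def \<delta>_def .
qed

end

section \<open>Return to the original definitions and the diameter\<close>

theorem corollary1p8:
  fixes G :: "'a pair_pre_digraph"
    and s c a k \<delta> :: nat
    and M :: int
  assumes "scak_graph s c a k G"
    and "connected G"
    and "a \<le> c"
    and "\<delta> = min_valency G"
    and "M = \<lceil>real a * (real c - real a) / (real c - 1)\<rceil>"
  shows "\<exists>d::nat. graph_diameter G = enat d \<and>
           int d \<le> max (2 * int s)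
             ((int s - 1) * (\<lfloor>2 * (real \<delta> - 2 * real c) / (2 + real_of_int M)\<rfloor> + 3) + 2)"
    (is "\<exists>d. _ \<and> int d \<le> ?b")
proof -
  note sc = assms(1)[unfolded scak_graph_def]
  interpret pair_bidirected_digraph G using sc by blast
  interpret connected_bidirected_digraph G using assms(2) by unfold_locales
  have out_arcs: "out_arcs G x = Pair x ` nbrs x" for x
    unfolding out_arcs_def nbrs_def by auto
  then have deg: "out_degree G x = card (nbrs x)" for x
    unfolding out_degree_def by (simp add: card_image inj_on_def)
  have spheres: "sphere G h x \<inter> sphere G 1 y = {w \<in> nbrs y. dst x w = h}"
    if "x \<in> pverts G" "y \<in> pverts G" for h x y
    using that graph_dist_eq dst_1_iff nbrs_verts unfolding sphere_def by auto
  interpret scak_connected G "s - 1" c a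
  proof
    show "finite (nbrs x)" if "x \<in> pverts G" for x
    proof -
      have "finite (out_arcs G x)" using that sc unfolding has_max_valency_def by blast
      then show ?thesis unfolding out_arcs by (simp add: finite_image_iff inj_on_def)
    qed
    have "girth G = enat (2 * s - 1) \<or> girth G = enat (2 * s)" using sc by blast
    then show "enat (2 * (s - 1) + 1) \<le> girth G" using sc by auto
    show "card {w \<in> nbrs y. dst x w = s - 1} = c"
      if "x \<in> pverts G" "y \<in> pverts G" "dst x y = Suc (s - 1)" for x y
    proof -
      have "Suc (s - 1) = s" using sc by simp
      then have "graph_dist G x y = enat s" using that(3) graph_dist_eq[OF that(1,2)] by argo
      then show ?thesis using sc that(1,2) spheres[OF that(1,2), of "s - 1"] by metis
    qed
    show "card {w \<in> nbrs y. dst x w = s - 1} = a"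
      if "x \<in> pverts G" "y \<in> pverts G" "dst x y = s - 1" for x y
    proof -
      have "graph_dist G x y = enat (s - 1)" using that(3) graph_dist_eq[OF that(1,2)] by argo
      then show ?thesis using sc that(1,2) spheres[OF that(1,2), of "s - 1"] by metis
    qed
  qed (use sc assms(3) in auto)
  have "pverts G \<noteq> {}" using sc unfolding has_max_valency_def by blast
  \<comment> \<open>A nonempty set of naturals attains its infimum.\<close>
  then have "\<delta> \<in> out_degree G ` pverts G"
    unfolding assms(4) min_valency_def by (intro Inf_nat_def1) simp
  then obtain m where m: "m \<in> pverts G" "card (nbrs m) = \<delta>" using deg by auto
  have bound: "int (dst x y) \<le> ?b" if "x \<in> pverts G" "y \<in> pverts G" for x y
  proof (cases "dst x y \<le> 2 * s")
    case False
    then have "2 * (s - 1) + 2 < dst x y" using sc by auto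
    from dst_bound[OF that this m(1) assms(5)] show ?thesis
      using m(2) sc by (simp add: of_nat_diff)
  qed simp
  \<comment> \<open>The maximum includes \<open>2 * s\<close>, so it is nonnegative and
    \<open>nat\<close> loses nothing; finiteness of the diameter follows as well.\<close>
  have "graph_diameter G \<le> enat (nat ?b)"
    unfolding graph_diameter_def
  proof (intro SUP_least)
    fix x y assume "x \<in> pverts G" "y \<in> pverts G"
    then show "graph_dist G x y \<le> enat (nat ?b)"
      using bound[of x y] graph_dist_eq[of x y] by (simp add: nat_le_iff le_nat_iff)
  qed
  then obtain d where "graph_diameter G = enat d" "d \<le> nat ?b"
    by (metis enat_ile enat_ord_simps(1))
  then show ?thesis by (intro exI[of _ d]) auto
qed

end
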